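(* For all positive integers $m$ and $n$ satisfying $m\leq\binom{n}{2}$ there is a simple graph $G$ with $n$ vertices and $m$ edges whose rectilinear space crossing number satisfies $\overline{\mathrm{cr}}_4(G)\leq 6720\, m^6/n^4$.
   Context: A straight-line spatial drawing of a graph $G$ represents the vertices by distinct points of $\mathbb{R}^3$ and each edge by the straight-line segment joining the points of its endpoints. A space crossing in such a drawing consists of four pairwise vertex-disjoint edges together with a line in $\mathbb{R}^3$ meeting all four segments; space crossings are counted by the quadruples of edges for which such a line exists. The rectilinear space crossing number $\overline{\mathrm{cr}}_4(G)$ is the least number of space crossings over all straight-line spatial drawings of $G$. *)

theory Defs
  imports "HOL-Analysis.Analysis"
begin

definition simple_graph :: "'a set \<Rightarrow> 'a set set \<Rightarrow> bool" where
  "simple_graph V E \<longleftrightarrow> finite V \<and> (\<forall>e\<in>E. e \<subseteq> V \<and> card e = 2)"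

definition straight_line_drawing :: "'a set \<Rightarrow> ('a \<Rightarrow> real ^ 3) \<Rightarrow> bool" where
  "straight_line_drawing V f \<longleftrightarrow> inj_on f V"

text \<open>
  Edges are two-element sets, so the segment of an edge is the convex hull of the images of
  its two endpoints; see \<open>edge_segment_doubleton\<close>.
\<close>

definition edge_segment :: "('a \<Rightarrow> real ^ 3) \<Rightarrow> 'a set \<Rightarrow> (real ^ 3) set" where
  "edge_segment f e = convex hull (f ` e)"

lemma edge_segment_doubleton: "edge_segment f {u, v} = closed_segment (f u) (f v)"
  by (simp add: edge_segment_def segment_convex_hull)

definition is_line :: "(real ^ 3) set \<Rightarrow> bool" where
  "is_line L \<longleftrightarrow> affine L \<and> aff_dim L = 1"

text \<open>
  Each unordered quadruple of edges contributes at most one crossing, however many lines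
  meet its four segments.
\<close>

definition space_crossings :: "'a set set \<Rightarrow> ('a \<Rightarrow> real ^ 3) \<Rightarrow> 'a set set set" where
  "space_crossings E f =
     {Q. Q \<subseteq> E \<and> card Q = 4 \<and> pairwise disjnt Q \<and>
         (\<exists>L. is_line L \<and> (\<forall>e\<in>Q. L \<inter> edge_segment f e \<noteq> {}))}"

definition rectilinear_space_crossing_number :: "'a set \<Rightarrow> 'a set set \<Rightarrow> nat" where
  "rectilinear_space_crossing_number V E =
     (LEAST k. \<exists>f. straight_line_drawing V f \<and> k = card (space_crossings E f))"

lemma ex_straight_line_drawing:
  assumes "finite V"
  shows "\<exists>f. straight_line_drawing V f"
proof -
  obtain g :: "'a \<Rightarrow> nat" where g: "inj_on g V"
    using finite_imp_inj_to_nat_seg[OF assms] by blast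
  have "inj_on (\<lambda>v. vec (real (g v)) :: real ^ 3) V"
  proof (rule inj_onI)
    fix u v
    assume uv: "u \<in> V" "v \<in> V" and "vec (real (g u)) = (vec (real (g v)) :: real ^ 3)"
    then have "g u = g v"
      by (metis of_nat_eq_iff vec_component)
    then show "u = v"
      using g uv by (simp add: inj_on_eq_iff)
  qed
  then show ?thesis
    unfolding straight_line_drawing_def by (rule exI[where P = "\<lambda>f. inj_on f V"])
qed

text \<open>The minimum is attained, and the sets counted are finite, so the cardinality is genuine.\<close>

lemma rectilinear_space_crossing_number_attained:
  assumes "simple_graph V E"
  shows "\<exists>f. straight_line_drawing V f \<and>
             rectilinear_space_crossing_number V E = card (space_crossings E f)"
proof -
  have "finite V"
    using assms by (simp add: simple_graph_def)
  then obtain f0 :: "'a \<Rightarrow> real ^ 3" where f0: "straight_line_drawing V f0"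
    using ex_straight_line_drawing by blast
  let ?P = "\<lambda>k. \<exists>f. straight_line_drawing V f \<and> k = card (space_crossings E f)"
  have "?P (card (space_crossings E f0))"
    by (rule exI[of _ f0], rule conjI[OF f0 refl])
  then have "?P (LEAST k. ?P k)"
    by (rule LeastI)
  then show ?thesis
    unfolding rectilinear_space_crossing_number_def .
qed

lemma finite_space_crossings:
  assumes "simple_graph V E"
  shows "finite (space_crossings E f)"
proof -
  have "E \<subseteq> Pow V" "finite V"
    using assms unfolding simple_graph_def by auto
  then have "finite E"
    using finite_subset[of E "Pow V"] by simp
  then have "finite (Pow E)"
    by simp
  moreover have "space_crossings E f \<subseteq> Pow E"
    unfolding space_crossings_def by blast
  ultimately show ?thesis
    by (rule finite_subset[rotated])
qed

end

theory Submission imports Defs begin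

text \<open>
  If \<open>m \<le> 3n - 6\<close>, or if \<open>n \<le> 7\<close>, there are no four pairwise disjoint edges at all, for a
  suitable graph (one whose edges all meet three fixed vertices). Otherwise split the vertices into
  about \<open>n / k\<close> clusters of size between \<open>k\<close> and \<open>2k\<close>, where \<open>k \<approx> 2m / n + 1\<close>, and take \<open>m\<close>
  edges inside clusters. Put cluster \<open>i\<close> on the vertical line over the point \<open>(i, i\<^sup>2)\<close> of a
  parabola. As no three points of the parabola are collinear, a line meets the hulls of at most
  two clusters, so every space crossing lives in the at most \<open>4k\<^sup>2\<close> edges of two clusters, and there
  are at most \<open>(n / k)\<^sup>2 (4k\<^sup>2)\<^sup>4 / 24 = O(n\<^sup>2 k\<^sup>6) = O(m\<^sup>6 / n\<^sup>4)\<close> of them.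
\<close>

lemma rectilinear_space_crossing_number_le:
  assumes "straight_line_drawing V f"
  shows "rectilinear_space_crossing_number V E \<le> card (space_crossings E f)"
  unfolding rectilinear_space_crossing_number_def
  by (rule Least_le) (use assms in blast)

subsection \<open>Graphs without four disjoint edges\<close>

text \<open>Four pairwise disjoint edges would already use eight vertices.\<close>

lemma space_crossings_empty_if_few_vertices:
  assumes "simple_graph V E" and "card V < 8"
  shows "space_crossings E f = {}"
proof (rule ccontr)
  assume "space_crossings E f \<noteq> {}"
  then obtain Q where Q: "Q \<subseteq> E" "card Q = 4" "pairwise disjnt Q"
    unfolding space_crossings_def by blast
  have fin: "finite V" and E: "\<And>e. e \<in> E \<Longrightarrow> e \<subseteq> V \<and> card e = 2"
    using assms(1) by (auto simp: simple_graph_def)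
  have "card (\<Union>Q) = (\<Sum>e\<in>Q. card e)"
    using Q E fin by (intro card_Union_disjoint) (auto intro: finite_subset)
  also have "\<dots> = (\<Sum>e\<in>Q. 2)"
    using Q E by (intro sum.cong) auto
  finally have "card (\<Union>Q) = 8"
    using Q by simp
  moreover have "card (\<Union>Q) \<le> card V"
    using Q E fin by (intro card_mono) auto
  ultimately show False
    using assms(2) by simp
qed

text \<open>Choosing from each edge of a crossing an endpoint in \<open>S\<close> gives an
  injection, because the edges are disjoint; so four edges would need four points of
  \<open>S\<close>.\<close>

lemma space_crossings_empty_if_small_cover:
  assumes "finite S" and "card S < 4" and "\<And>e. e \<in> E \<Longrightarrow> e \<inter> S \<noteq> {}"
  shows "space_crossings E f = {}"
proof (rule ccontr)
  assume "space_crossings E f \<noteq> {}"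
  then obtain Q where Q: "Q \<subseteq> E" "card Q = 4" "pairwise disjnt Q"
    unfolding space_crossings_def by blast
  have "\<forall>e\<in>Q. \<exists>v. v \<in> e \<inter> S"
    using Q(1) assms(3) by blast
  then obtain h where h: "\<And>e. e \<in> Q \<Longrightarrow> h e \<in> e \<inter> S"
    by metis
  have "inj_on h Q"
  proof (rule inj_onI)
    fix d e assume de: "d \<in> Q" "e \<in> Q" "h d = h e"
    then have "\<not> disjnt d e"
      using h by (metis IntD1 disjnt_iff)
    then show "d = e"
      using Q(3) de by (auto simp: pairwise_def)
  qed
  then have "card Q \<le> card S"
    using h assms(1) by (intro card_inj_on_le[of h]) auto
  then show False
    using Q(2) assms(2) by simp
qed

lemma card_pairs_meeting:
  fixes S V :: "'a set"
  assumes "finite V" and "S \<subseteq> V"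
  shows "card {e. e \<subseteq> V \<and> card e = 2 \<and> e \<inter> S \<noteq> {}}
         = (card V choose 2) - (card (V - S) choose 2)"
proof -
  have "{e. e \<subseteq> V \<and> card e = 2 \<and> e \<inter> S \<noteq> {}}
      = {e. e \<subseteq> V \<and> card e = 2} - {e. e \<subseteq> V - S \<and> card e = 2}"
    by blast
  moreover have "card \<dots> = card {e. e \<subseteq> V \<and> card e = 2} - card {e. e \<subseteq> V - S \<and> card e = 2}"
    using assms by (intro card_Diff_subset) (auto intro: finite_subset[of _ "Pow V"])
  ultimately show ?thesis
    using assms by (simp add: n_subsets)
qed

text \<open>This covers the range where \<open>m\<close> is small compared with \<open>n\<close>:
  there the claimed bound can drop below 1, so only a graph with no crossings at all will
  do.\<close>

lemma ex_graph_without_space_crossings: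
  fixes m n :: nat
  assumes "m \<le> n choose 2" and "n < 8 \<or> m \<le> 3 * n - 6"
  shows "\<exists>(V :: nat set) E. simple_graph V E \<and> card V = n \<and> card E = m \<and>
           rectilinear_space_crossing_number V E = 0"
proof -
  let ?V = "{..<n}"
  have "\<exists>E. simple_graph ?V E \<and> card E = m \<and> (\<forall>f. space_crossings E f = {})"
  proof (cases "n < 8")
    case True
    have "m \<le> card {e. e \<subseteq> ?V \<and> card e = 2}"
      using assms(1) by (simp add: n_subsets)
    then obtain E where E: "E \<subseteq> {e. e \<subseteq> ?V \<and> card e = 2}" "card E = m"
      by (rule obtain_subset_with_card_n)
    then have "simple_graph ?V E"
      by (auto simp: simple_graph_def)
    then show ?thesis
      using E(2) True space_crossings_empty_if_few_vertices[of ?V E] by auto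
  next
    case False
    \<comment> \<open>Writing \<open>n\<close> as \<open>j + 3\<close> avoids truncated subtraction:
      the difference of the two binomials is \<open>3 * j + 3\<close>, that is
      \<open>3 * n - 6\<close>.\<close>
    define j where "j = n - 3"
    have j: "n = j + 3"
      using False by (simp add: j_def)
    let ?P = "{e. e \<subseteq> ?V \<and> card e = 2 \<and> e \<inter> {..<3} \<noteq> {}}"
    have "card (?V - {..<3}) = j"
      using j by (simp add: card_Diff_subset)
    then have "card ?P = (n choose 2) - (j choose 2)"
      using card_pairs_meeting[of ?V "{..<3}"] j by simp
    also have "\<dots> = 3 * n - 6"
      using j by (simp add: numeral_eq_Suc)
    finally have "m \<le> card ?P"
      using assms(2) False by simp
    then obtain E where E: "E \<subseteq> ?P" "card E = m"
      by (rule obtain_subset_with_card_n)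
    then have "simple_graph ?V E"
      by (auto simp: simple_graph_def)
    moreover have "space_crossings E f = {}" for f
      using E(1) by (intro space_crossings_empty_if_small_cover[of "{..<3}"]) auto
    ultimately show ?thesis
      using E(2) by auto
  qed
  then obtain E where E: "simple_graph ?V E" "card E = m" "\<And>f. space_crossings E f = {}"
    by blast
  then have "rectilinear_space_crossing_number ?V E = 0"
    using rectilinear_space_crossing_number_attained[OF E(1)] by auto
  then show ?thesis
    using E by (intro exI[of _ ?V] exI[of _ E]) auto
qed

subsection \<open>Drawings stacked over a parabola\<close>

text \<open>Here \<open>c\<close> assigns clusters to vertices. The height is the vertex number
  itself, so the drawing is injective whatever \<open>c\<close> is.\<close>

definition stacked_drawing :: "(nat \<Rightarrow> nat) \<Rightarrow> nat \<Rightarrow> real ^ 3" where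
  "stacked_drawing c v = vector [real (c v), (real (c v))\<^sup>2, real v]"

lemma straight_line_drawing_stacked: "straight_line_drawing V (stacked_drawing c)"
  unfolding straight_line_drawing_def inj_on_def stacked_drawing_def
  by (metis of_nat_eq_iff vector_3(3))

text \<open>A vertical line is convex, so it contains the hull of any of its points.\<close>

lemma edge_segment_stacked:
  assumes "x \<in> edge_segment (stacked_drawing c) e" and "\<And>v. v \<in> e \<Longrightarrow> c v = i"
  shows "x $ 1 = real i \<and> x $ 2 = (real i)\<^sup>2"
proof -
  have "convex {x :: real ^ 3. x $ 1 = real i \<and> x $ 2 = (real i)\<^sup>2}"
    by (rule convexI) (auto simp flip: distrib_right)
  moreover have "stacked_drawing c ` e \<subseteq> {x. x $ 1 = real i \<and> x $ 2 = (real i)\<^sup>2}"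
    using assms(2) by (auto simp: stacked_drawing_def)
  ultimately have "edge_segment (stacked_drawing c) e
      \<subseteq> {x. x $ 1 = real i \<and> x $ 2 = (real i)\<^sup>2}"
    unfolding edge_segment_def by (intro hull_minimal)
  then show ?thesis
    using assms(1) by auto
qed

text \<open>Projected to the first two coordinates, the three points stay collinear. Eliminating the
  direction \<open>u\<close> leaves a Vandermonde product \<open>(a - d) * (b - d) * (b - a)\<close>
  that must vanish. A vertical \<open>L\<close> needs no separate treatment.\<close>

lemma line_meets_two_parabola_verticals:
  fixes L :: "(real ^ 3) set" and a b d :: real
  assumes "is_line L" and "p \<in> L" "q \<in> L" "r \<in> L"
    and "p $ 1 = a" "p $ 2 = a\<^sup>2" "q $ 1 = b" "q $ 2 = b\<^sup>2" "r $ 1 = d" "r $ 2 = d\<^sup>2"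
  shows "a = b \<or> a = d \<or> b = d"
proof -
  have "collinear L"
    using assms(1) by (simp add: is_line_def collinear_aff_dim)
  then obtain u where "\<And>x y. x \<in> L \<Longrightarrow> y \<in> L \<Longrightarrow> \<exists>c. x - y = c *\<^sub>R u"
    unfolding collinear_def by blast
  then obtain s t where s: "p - r = s *\<^sub>R u" and t: "q - r = t *\<^sub>R u"
    using assms(2-4) by metis
  have "a - d = s * u $ 1" "a\<^sup>2 - d\<^sup>2 = s * u $ 2" "b - d = t * u $ 1" "b\<^sup>2 - d\<^sup>2 = t * u $ 2"
    using arg_cong[OF s, of "\<lambda>x. x $ 1"] arg_cong[OF s, of "\<lambda>x. x $ 2"]
      arg_cong[OF t, of "\<lambda>x. x $ 1"] arg_cong[OF t, of "\<lambda>x. x $ 2"] assms(5-) by simp_all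
  then have "(a - d) * (b\<^sup>2 - d\<^sup>2) = (b - d) * (a\<^sup>2 - d\<^sup>2)"
    by simp
  then have "(a - d) * (b - d) * (b - a) = 0"
    by algebra
  then show ?thesis
    by auto
qed

text \<open>Each crossing is charged to an ordered pair of clusters, possibly equal, that together
  contain its four edges. There are \<open>t\<^sup>2\<close> such pairs, each offering at most
  \<open>2 * (s choose 2)\<close> edges.\<close>

lemma card_space_crossings_stacked_le:
  fixes c :: "nat \<Rightarrow> nat"
  assumes "finite V" and "c ` V \<subseteq> {..<t}"
    and size: "\<And>i. i < t \<Longrightarrow> card {v\<in>V. c v = i} \<le> s"
    and E: "E \<subseteq> (\<Union>i<t. {e. e \<subseteq> {v\<in>V. c v = i} \<and> card e = 2})"
  shows "card (space_crossings E (stacked_drawing c)) \<le> t\<^sup>2 * ((2 * (s choose 2)) choose 4)"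
proof -
  define D where "D i = {e. e \<subseteq> {v\<in>V. c v = i} \<and> card e = 2}" for i
  define F where "F ij = {Q. Q \<subseteq> D (fst ij) \<union> D (snd ij) \<and> card Q = 4}" for ij
  have finD: "finite (D i)" for i
    using assms(1) unfolding D_def by (auto intro: finite_subset[of _ "Pow V"])
  have "card (D i) \<le> s choose 2" if "i < t" for i
    unfolding D_def using assms(1) size[OF that] by (simp add: n_subsets binomial_right_mono)
  then have cardDD: "card (D i \<union> D j) \<le> 2 * (s choose 2)" if "i < t" "j < t" for i j
    using card_Un_le[of "D i" "D j"] add_mono[of "card (D i)" _ "card (D j)"] that
    by (metis mult_2 order.trans)
  have cardF: "card (F ij) \<le> (2 * (s choose 2)) choose 4" if "ij \<in> {..<t} \<times> {..<t}" for ij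
    unfolding F_def using finD cardDD that
    by (auto simp: n_subsets intro!: binomial_right_mono)
  have finF: "finite (F ij)" for ij
    unfolding F_def by (rule finite_subset[of _ "Pow (D (fst ij) \<union> D (snd ij))"]) (use finD in auto)
  have "space_crossings E (stacked_drawing c) \<subseteq> (\<Union>ij\<in>{..<t} \<times> {..<t}. F ij)"
  proof
    fix Q assume "Q \<in> space_crossings E (stacked_drawing c)"
    then obtain L where Q: "Q \<subseteq> E" "card Q = 4" and L: "is_line L"
      and meets: "\<And>e. e \<in> Q \<Longrightarrow> L \<inter> edge_segment (stacked_drawing c) e \<noteq> {}"
      unfolding space_crossings_def by blast
    have "\<forall>e\<in>Q. \<exists>i<t. e \<in> D i"
      using Q(1) E unfolding D_def by blast
    then obtain g where g: "\<And>e. e \<in> Q \<Longrightarrow> g e < t \<and> e \<in> D (g e)"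
      by metis
    have "\<exists>x\<in>L. x $ 1 = real (g e) \<and> x $ 2 = (real (g e))\<^sup>2" if "e \<in> Q" for e
      using meets[OF that] g[OF that] edge_segment_stacked[of _ c e "g e"]
      unfolding D_def by blast
    then obtain x where x: "\<And>e. e \<in> Q \<Longrightarrow> x e \<in> L \<and> x e $ 1 = real (g e) \<and> x e $ 2 = (real (g e))\<^sup>2"
      by metis
    have two: "g d = g e \<or> g d = g h \<or> g e = g h" if "d \<in> Q" "e \<in> Q" "h \<in> Q" for d e h
      using line_meets_two_parabola_verticals[OF L, of "x d" "x e" "x h"
          "real (g d)" "real (g e)" "real (g h)"] x that by simp
    obtain d where d: "d \<in> Q"
      using Q(2) by fastforce
    \<comment> \<open>If some edge lies in another cluster than \<open>d\<close>, take it as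
      \<open>e\<close>; then \<open>two\<close> excludes a third cluster. Otherwise \<open>e\<close>
      can be \<open>d\<close> itself.\<close>
    obtain e where e: "e \<in> Q" "\<And>h. h \<in> Q \<Longrightarrow> g h = g d \<or> g h = g e"
      using two d by metis
    have "Q \<in> F (g d, g e)"
      unfolding F_def using e(2) g Q(2) by fastforce
    then show "Q \<in> (\<Union>ij\<in>{..<t} \<times> {..<t}. F ij)"
      using d e(1) g by blast
  qed
  then have "card (space_crossings E (stacked_drawing c)) \<le> card (\<Union>ij\<in>{..<t} \<times> {..<t}. F ij)"
    using finF by (intro card_mono) auto
  also have "\<dots> \<le> (\<Sum>ij\<in>{..<t} \<times> {..<t}. card (F ij))"
    by (rule card_UN_le) simp
  also have "\<dots> \<le> (\<Sum>ij\<in>{..<t} \<times> {..<t}. (2 * (s choose 2)) choose 4)"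
    by (rule sum_mono) (rule cardF)
  finally show ?thesis
    by (simp add: power2_eq_square)
qed

subsection \<open>Clusters of consecutive vertices\<close>

text \<open>Inside its cluster each vertex has at least \<open>k - 1\<close> possible partners, and
  summing over all vertices counts every pair twice.\<close>

lemma card_pairs_in_clusters_ge:
  fixes c :: "'a \<Rightarrow> nat"
  assumes "finite V" and "c ` V \<subseteq> {..<t}"
    and size: "\<And>i. i < t \<Longrightarrow> k \<le> card {v\<in>V. c v = i}"
  shows "card V * (k - 1) \<le> 2 * card (\<Union>i<t. {e. e \<subseteq> {v\<in>V. c v = i} \<and> card e = 2})"
proof -
  define C where "C i = {v\<in>V. c v = i}" for i
  have finC: "finite (C i)" for i
    using assms(1) by (simp add: C_def)
  have "V = (\<Union>i<t. C i)"
    using assms(2) by (auto simp: C_def)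
  then have "card V = (\<Sum>i<t. card (C i))"
    using card_UN_disjoint[of "{..<t}" C] finC by (auto simp: C_def)
  then have "card V * (k - 1) = (\<Sum>i<t. card (C i) * (k - 1))"
    by (simp add: sum_distrib_right)
  also have "\<dots> \<le> (\<Sum>i<t. 2 * (card (C i) choose 2))"
  proof (rule sum_mono)
    fix i assume "i \<in> {..<t}"
    then have "card (C i) * (k - 1) \<le> card (C i) * (card (C i) - 1)"
      using size by (intro mult_le_mono2 diff_le_mono) (simp add: C_def)
    moreover have "2 * (card (C i) choose 2) = card (C i) * (card (C i) - 1)"
      unfolding choose_two by (cases "card (C i) = 0") simp_all
    ultimately show "card (C i) * (k - 1) \<le> 2 * (card (C i) choose 2)"
      by simp
  qed
  also have "\<dots> = 2 * (\<Sum>i<t. card {e. e \<subseteq> C i \<and> card e = 2})"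
    using finC by (simp add: n_subsets sum_distrib_left)
  also have "(\<Sum>i<t. card {e. e \<subseteq> C i \<and> card e = 2}) = card (\<Union>i<t. {e. e \<subseteq> C i \<and> card e = 2})"
  proof (rule card_UN_disjoint[symmetric])
    show "\<forall>i\<in>{..<t}. finite {e. e \<subseteq> C i \<and> card e = 2}"
      using finC by (auto intro: finite_subset[of _ "Pow (C _)"])
    show "\<forall>i\<in>{..<t}. \<forall>j\<in>{..<t}. i \<noteq> j \<longrightarrow>
        {e. e \<subseteq> C i \<and> card e = 2} \<inter> {e. e \<subseteq> C j \<and> card e = 2} = {}"
    proof (intro ballI impI)
      fix i j :: nat assume "i \<noteq> j"
      then have disj: "C i \<inter> C j = {}"
        by (auto simp: C_def)
      show "{e. e \<subseteq> C i \<and> card e = 2} \<inter> {e. e \<subseteq> C j \<and> card e = 2} = {}"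
      proof (rule equals0I)
        fix e assume "e \<in> {e. e \<subseteq> C i \<and> card e = 2} \<inter> {e. e \<subseteq> C j \<and> card e = 2}"
        then have "e \<subseteq> C i \<inter> C j" and "card e = 2"
          by auto
        then show False
          unfolding disj by simp
      qed
    qed
  qed simp
  finally show ?thesis
    by (simp add: C_def)
qed

lemma ex_clustering:
  fixes n k :: nat
  assumes "0 < k" and "k \<le> n"
  obtains c where "c ` {..<n} \<subseteq> {..<n div k}"
    and "\<And>i. i < n div k \<Longrightarrow> k \<le> card {v\<in>{..<n}. c v = i}"
    and "\<And>i. i < n div k \<Longrightarrow> card {v\<in>{..<n}. c v = i} \<le> 2 * k"
proof
  define t where "t = n div k"
  \<comment> \<open>Blocks of \<open>k\<close> consecutive numbers; \<open>min\<close> merges the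
    incomplete block at the end, if any, into the last full one.\<close>
  define c where "c v = min (v div k) (t - 1)" for v
  have t: "0 < t" "t * k \<le> n" "n < (t + 1) * k"
    using assms unfolding t_def
    by (auto simp: div_greater_zero_iff dividend_less_div_times)
  show "c ` {..<n} \<subseteq> {..<n div k}"
    using t(1) by (auto simp: c_def t_def[symmetric])
  fix i assume i: "i < n div k"
  then have it: "i < t"
    by (simp add: t_def)
  have "(i + 1) * k \<le> n"
    using it t(2) by (metis Suc_eq_plus1 Suc_leI le_trans mult_le_mono1)
  moreover have "c v = i" if "i * k \<le> v" "v < (i + 1) * k" for v
  proof -
    have "v div k = i"
      using that by (intro div_nat_eqI) (auto simp: mult.commute)
    then show ?thesis
      using it by (simp add: c_def)
  qed
  ultimately have "{i * k..<(i + 1) * k} \<subseteq> {v\<in>{..<n}. c v = i}"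
    by auto
  then have "card {i * k..<(i + 1) * k} \<le> card {v\<in>{..<n}. c v = i}"
    by (intro card_mono) auto
  then show "k \<le> card {v\<in>{..<n}. c v = i}"
    by simp
  \<comment> \<open>Only the last cluster, \<open>i = t - 1\<close>, can reach beyond
    \<open>(i + 1) * k\<close>, and \<open>v div k \<le> t\<close> stops it before
    \<open>(i + 2) * k\<close>.\<close>
  have "{v\<in>{..<n}. c v = i} \<subseteq> {i * k..<(i + 2) * k}"
  proof
    fix v assume "v \<in> {v\<in>{..<n}. c v = i}"
    then have v: "v < n" "min (v div k) (t - 1) = i"
      by (auto simp: c_def)
    then have "i \<le> v div k"
      by simp
    then have "i * k \<le> v"
      using assms(1) by (simp add: less_eq_div_iff_mult_less_eq)
    have "v div k < t + 1"
      using v(1) t(3) by (simp add: less_mult_imp_div_less)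
    then have "v div k < i + 2"
      using v(2) by linarith
    then have "v < (i + 2) * k"
      using assms(1) by (simp add: div_less_iff_less_mult)
    with \<open>i * k \<le> v\<close> show "v \<in> {i * k..<(i + 2) * k}"
      by simp
  qed
  then have "card {v\<in>{..<n}. c v = i} \<le> card {i * k..<(i + 2) * k}"
    by (intro card_mono) auto
  then show "card {v\<in>{..<n}. c v = i} \<le> 2 * k"
    by (simp add: algebra_simps)
qed

lemma ex_clustered_graph:
  fixes m n k :: nat
  assumes "0 < k" and "k \<le> n" and "2 * m \<le> n * (k - 1)"
  shows "\<exists>(V :: nat set) E. simple_graph V E \<and> card V = n \<and> card E = m \<and>
           rectilinear_space_crossing_number V E \<le> (n div k)\<^sup>2 * ((2 * (2 * k choose 2)) choose 4)"
proof -
  let ?V = "{..<n}"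
  obtain c where c: "c ` ?V \<subseteq> {..<n div k}"
    "\<And>i. i < n div k \<Longrightarrow> k \<le> card {v\<in>?V. c v = i}"
    "\<And>i. i < n div k \<Longrightarrow> card {v\<in>?V. c v = i} \<le> 2 * k"
    using ex_clustering[OF assms(1,2)] by blast
  let ?P = "\<Union>i<n div k. {e. e \<subseteq> {v\<in>?V. c v = i} \<and> card e = 2}"
  have "m \<le> card ?P"
    using card_pairs_in_clusters_ge[OF _ c(1,2)] assms(3) by simp
  then obtain E where E: "E \<subseteq> ?P" "card E = m"
    by (rule obtain_subset_with_card_n)
  have "simple_graph ?V E"
    using E(1) by (fastforce simp: simple_graph_def)
  moreover have "rectilinear_space_crossing_number ?V E
      \<le> (n div k)\<^sup>2 * ((2 * (2 * k choose 2)) choose 4)"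
    using rectilinear_space_crossing_number_le[OF straight_line_drawing_stacked]
      card_space_crossings_stacked_le[OF _ c(1,3) E(1)] by (rule order.trans) simp
  ultimately show ?thesis
    using E(2) by (intro exI[of _ ?V] exI[of _ E]) simp
qed

section \<open>Numerical estimates and the choice of the cluster size\<close>

lemma clustered_crossing_bound:
  fixes n k :: nat
  shows "real ((n div k)\<^sup>2 * ((2 * (2 * k choose 2)) choose 4)) \<le> 32 / 3 * real n ^ 2 * real k ^ 6"
proof -
  have "2 * (2 * k choose 2) \<le> 4 * k\<^sup>2"
    by (simp add: choose_two power2_eq_square algebra_simps)
  then have "((2 * (2 * k choose 2)) choose 4) * fact 4 \<le> (4 * k\<^sup>2) ^ 4"
    by (metis binomial_fact_pow order.trans power_mono zero_le)
  then have "((2 * (2 * k choose 2)) choose 4) * 24 \<le> 256 * k ^ 8"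
    by (simp add: fact_numeral power_mult_distrib)
  then have "(n div k)\<^sup>2 * (((2 * (2 * k choose 2)) choose 4) * 24) \<le> (n div k)\<^sup>2 * (256 * k ^ 8)"
    by (rule mult_le_mono2)
  \<comment> \<open>Two of the eight factors \<open>k\<close> are absorbed by
    \<open>n div k * k \<le> n\<close>; the factor 32 / 3 is 256 / 24.\<close>
  also have "\<dots> = 256 * (n div k * k)\<^sup>2 * k ^ 6"
    by (simp add: power_mult_distrib flip: power_add)
  also have "\<dots> \<le> 256 * n\<^sup>2 * k ^ 6"
    by (intro mult_le_mono power_mono) auto
  finally have "real ((n div k)\<^sup>2 * (((2 * (2 * k choose 2)) choose 4) * 24)) \<le> real (256 * n\<^sup>2 * k ^ 6)"
    by (rule of_nat_mono)
  then show ?thesis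
    by simp
qed

theorem theorem2:
  fixes m n :: nat
  assumes "m > 0" and "n > 0" and "m \<le> n choose 2"
  shows "\<exists>(V :: nat set) E. simple_graph V E \<and> card V = n \<and> card E = m \<and>
           real (rectilinear_space_crossing_number V E) \<le> 6720 * real m ^ 6 / real n ^ 4"
proof (cases "n < 8 \<or> m \<le> 3 * n - 6")
  case True
  then obtain V :: "nat set" and E where "simple_graph V E" "card V = n" "card E = m"
    "rectilinear_space_crossing_number V E = 0"
    using ex_graph_without_space_crossings[OF assms(3)] by blast
  then show ?thesis
    by (intro exI[of _ V] exI[of _ E]) simp
next
  case False
  \<comment> \<open>\<open>q\<close> is \<open>2 * m / n\<close> rounded up, the least value with
    \<open>2 * m \<le> n * q\<close>. Clusters of size at least \<open>q + 1\<close> then contain at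
    least \<open>m\<close> pairs.\<close>
  define q where "q = (2 * m + n - 1) div n"
  define k where "k = q + 1"
  have q: "2 * m \<le> n * q" "n * q \<le> 2 * m + n - 1"
  proof -
    show "n * q \<le> 2 * m + n - 1"
      unfolding q_def by (rule times_div_less_eq_dividend)
    have "2 * m + n - 1 < n * q + n"
      unfolding q_def using dividend_less_times_div[OF assms(2), of "2 * m + n - 1"]
      by (simp add: add.commute)
    then show "2 * m \<le> n * q"
      by simp
  qed
  \<comment> \<open>The bound on \<open>m\<close> keeps \<open>q\<close> below \<open>n\<close>, so
    that a cluster of size \<open>k\<close> fits into the vertex set.\<close>
  have "2 * m \<le> n * (n - 1)"
    using assms(3) by (simp add: choose_two)
  moreover have "n * (n - 1) + n = n * n"
    using assms(2) by (simp add: right_diff_distrib')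
  ultimately have "n * q < n * n"
    using q(2) assms(2) by linarith
  then have k: "0 < k" "k \<le> n" "2 * m \<le> n * (k - 1)"
    using q(1) by (auto simp: k_def)
  then obtain V :: "nat set" and E where G: "simple_graph V E" "card V = n" "card E = m"
    "rectilinear_space_crossing_number V E \<le> (n div k)\<^sup>2 * ((2 * (2 * k choose 2)) choose 4)"
    using ex_clustered_graph by blast
  have "n * k \<le> 2 * m + 2 * n"
    using q(2) by (simp add: k_def)
  \<comment> \<open>From \<open>m \<ge> 3 * n - 5\<close> follows
    \<open>8 * m \<ge> 24 * n - 40\<close>, and \<open>5 * n \<ge> 40\<close> since
    \<open>n \<ge> 8\<close>. The rounding loss \<open>2 * n\<close> then costs at most
    \<open>16 / 19 * m\<close>, which explains 54 / 19.\<close>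
  moreover have "19 * n \<le> 8 * m"
    using False by linarith
  ultimately have "19 * (n * k) \<le> 54 * m"
    by linarith
  then have "real (19 * (n * k)) \<le> real (54 * m)"
    by (rule of_nat_mono)
  then have nk: "real n * real k \<le> 54 / 19 * real m"
    by simp
  have "real (rectilinear_space_crossing_number V E) \<le> 32 / 3 * real n ^ 2 * real k ^ 6"
    using of_nat_mono[OF G(4)] clustered_crossing_bound[of n k] by (rule order.trans)
  also have "\<dots> = 32 / 3 * (real n * real k) ^ 6 / real n ^ 4"
    using assms(2) by (simp add: field_simps flip: power_add)
  also have "\<dots> \<le> 32 / 3 * (54 / 19 * real m) ^ 6 / real n ^ 4"
    using nk by (intro divide_right_mono mult_left_mono power_mono) auto
  also have "\<dots> = 32 / 3 * (54 / 19) ^ 6 * real m ^ 6 / real n ^ 4"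
    using power_mult_distrib[of "54 / 19" "real m" 6] by (simp only: mult.assoc)
  \<comment> \<open>The constant on the left is about 5622.\<close>
  also have "\<dots> \<le> 6720 * real m ^ 6 / real n ^ 4"
    by (intro divide_right_mono mult_right_mono) (auto simp: power_divide)
  finally show ?thesis
    using G by (intro exI[of _ V] exI[of _ E]) simp
qed

end
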